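(* Let $v$ be an irrational unit vector in $\mathbb{R}^2$. Then for every $r>0$ there exists a symplectic embedding from $P^{4}(r)$ to $Y^{4}(1,v)$. In particular, any bounded domain in $T^*\mathbb{T}^2$ can be symplectically embedded into $Y^{4}(1,v)$.
   Context: $\mathbb{T}^2=\mathbb{R}^2/\mathbb{Z}^2$, and $T^*\mathbb{T}^2=\mathbb{T}^2\times\mathbb{R}^2$ carries the canonical symplectic form $\omega_{\mathrm{can}}=d\lambda_{\mathrm{can}}$. A vector $v\in\mathbb{R}^2$ is irrational if it is not a scalar multiple of any integer vector in $\mathbb{R}^2$. For $r>0$ and a unit vector $v\in\mathbb{R}^2$ define $$P^{4}(r)=\mathbb{T}^2\times\{(x_1,x_2)\in\mathbb{R}_{\ge 0}^2 : x_1+x_2\le r\},$$ $$Y^{4}(r,v)=\mathbb{T}^2\times(-r,r)v\times v^{\perp},$$ where $v^\perp$ is the line through the origin in the fiber $\mathbb{R}^2$ perpendicular to $v$; that is, $Y^4(r,v)=\{(q,p)\in\mathbb{T}^2\times\mathbb{R}^2 : |p\cdot v|<r\}$. A domain in $T^*\mathbb{T}^2$ is bounded if its projection to the fiber factor $\mathbb{R}^2$ is bounded. A symplectic embedding of a subset $S\subset T^*\mathbb{T}^2$ that is not open (such as $P^4(r)$) into $Y$ means a map $S\to Y$ that is the restriction to $S$ of a smooth embedding $\Phi$ of an open neighbourhood of $S$ into $T^*\mathbb{T}^2$ with $\Phi^*\omega_{\mathrm{can}}=\omega_{\mathrm{can}}$. *)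

theory Defs
  imports "HOL-Analysis.Analysis"
begin

definition integer_vec :: "real^2 \<Rightarrow> bool"
  where "integer_vec z \<longleftrightarrow> (\<forall>i. z $ i \<in> \<int>)"

definition torus_rel :: "real^2 \<Rightarrow> real^2 \<Rightarrow> bool"
  where "torus_rel x y \<longleftrightarrow> integer_vec (x - y)"

lemma equivp_torus_rel: "equivp torus_rel"
proof (rule equivpI)
  show "reflp torus_rel"
    by (simp add: reflp_def torus_rel_def integer_vec_def)
  show "symp torus_rel"
    unfolding symp_def torus_rel_def integer_vec_def
    by (metis Ints_minus minus_diff_eq vector_uminus_component)
  show "transp torus_rel"
  proof (rule transpI)
    fix x y z assume "torus_rel x y" "torus_rel y z"
    then have "x $ i - y $ i \<in> \<int>" "y $ i - z $ i \<in> \<int>" for i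
      by (auto simp: torus_rel_def integer_vec_def)
    then have "(x $ i - y $ i) + (y $ i - z $ i) \<in> \<int>" for i
      by (intro Ints_add)
    then show "torus_rel x z"
      by (simp add: torus_rel_def integer_vec_def)
  qed
qed

quotient_type torus = "real^2" / torus_rel
  morphisms rep_torus proj_torus
  by (rule equivp_torus_rel)

instantiation torus :: topological_space
begin

definition open_torus :: "torus set \<Rightarrow> bool"
  where "open_torus U \<longleftrightarrow> open (proj_torus -` U)"

instance
proof
  show "open (UNIV :: torus set)"
    by (simp add: open_torus_def)
  show "open (S \<inter> T)" if "open S" "open T" for S T :: "torus set"
    using that by (simp add: open_torus_def vimage_Int open_Int)
  show "open (\<Union>K)" if "\<forall>S\<in>K. open S" for K :: "torus set set"
    using that by (simp add: open_torus_def vimage_Union open_UN)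
qed

end

text \<open>The cotangent bundle is trivialised as \<open>torus \<times> real^2\<close> (base point, fibre coordinate).
  Its local coordinates are the local inverses of the universal covering
  \<open>cover (q, p) = ([q], p)\<close>, and tangent vectors of the cotangent bundle are identified with
  pairs \<open>(a, b)\<close> by means of these coordinates.\<close>

type_synonym cotangent = "torus \<times> (real^2)"
type_synonym coords = "(real^2) \<times> (real^2)"

definition cover :: "coords \<Rightarrow> cotangent"
  where "cover = map_prod proj_torus id"

text \<open>On an open set, \<open>C_k k f S\<close> says that all iterated directional derivatives of \<open>f\<close>
  up to order \<open>k\<close> exist and are continuous, i.e. that \<open>f\<close> is of class \<open>C\<^sup>k\<close>.\<close>

primrec C_k :: "nat \<Rightarrow> ('a::euclidean_space \<Rightarrow> 'b::euclidean_space) \<Rightarrow> 'a set \<Rightarrow> bool" where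
  "C_k 0 f S \<longleftrightarrow> continuous_on S f"
| "C_k (Suc k) f S \<longleftrightarrow> (\<forall>x\<in>S. f differentiable (at x)) \<and>
     (\<forall>u. C_k k (\<lambda>x. frechet_derivative f (at x) u) S)"

definition smooth_on :: "('a::euclidean_space \<Rightarrow> 'b::euclidean_space) \<Rightarrow> 'a set \<Rightarrow> bool"
  where "smooth_on f S \<longleftrightarrow> (\<forall>k. C_k k f S)"

text \<open>A smooth coordinate expression \<open>F\<close> of a map \<open>\<Phi>\<close> of the cotangent bundle, over an
  open set \<open>W\<close> of the universal cover. Two such expressions near a point differ by integer
  translations of the base coordinate in source and target, so their derivatives agree; hence
  conditions on derivatives below may be imposed on all of them.\<close>

definition local_lift :: "(cotangent \<Rightarrow> cotangent) \<Rightarrow> (coords \<Rightarrow> coords) \<Rightarrow> coords set \<Rightarrow> bool"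
  where "local_lift \<Phi> F W \<longleftrightarrow>
    open W \<and> smooth_on F W \<and> (\<forall>z\<in>W. cover (F z) = \<Phi> (cover z))"

definition smooth_map_on :: "cotangent set \<Rightarrow> (cotangent \<Rightarrow> cotangent) \<Rightarrow> bool"
  where "smooth_map_on U \<Phi> \<longleftrightarrow>
    (\<forall>z. cover z \<in> U \<longrightarrow> (\<exists>W F. z \<in> W \<and> cover ` W \<subseteq> U \<and> local_lift \<Phi> F W))"

definition immersion_on :: "cotangent set \<Rightarrow> (cotangent \<Rightarrow> cotangent) \<Rightarrow> bool"
  where "immersion_on U \<Phi> \<longleftrightarrow> smooth_map_on U \<Phi> \<and>
    (\<forall>W F. local_lift \<Phi> F W \<and> cover ` W \<subseteq> U \<longrightarrow>
      (\<forall>z\<in>W. inj (frechet_derivative F (at z))))"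

definition smooth_embedding_on :: "cotangent set \<Rightarrow> (cotangent \<Rightarrow> cotangent) \<Rightarrow> bool"
  where "smooth_embedding_on U \<Phi> \<longleftrightarrow>
    immersion_on U \<Phi> \<and> (\<exists>\<Psi>. homeomorphism U (\<Phi> ` U) \<Phi> \<Psi>)"

text \<open>The canonical forms are given in coordinates; they do not depend on the base coordinate,
  so they descend along \<open>cover\<close>.\<close>

definition lambda_can :: "coords \<Rightarrow> coords \<Rightarrow> real"
  where "lambda_can z u = snd z \<bullet> fst u"

definition exterior_derivative ::
  "('a::euclidean_space \<Rightarrow> 'a \<Rightarrow> real) \<Rightarrow> 'a \<Rightarrow> 'a \<Rightarrow> 'a \<Rightarrow> real"
  where "exterior_derivative \<alpha> z u w =
    frechet_derivative (\<lambda>y. \<alpha> y w) (at z) u - frechet_derivative (\<lambda>y. \<alpha> y u) (at z) w"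

definition omega_can :: "coords \<Rightarrow> coords \<Rightarrow> coords \<Rightarrow> real"
  where "omega_can = exterior_derivative lambda_can"

lemma omega_can_eq: "omega_can z u w = snd u \<bullet> fst w - snd w \<bullet> fst u"
proof -
  have "((\<lambda>y. lambda_can y w) has_derivative (\<lambda>u. lambda_can u w)) (at z)" for w
    unfolding lambda_can_def by (auto intro!: derivative_eq_intros)
  then have "frechet_derivative (\<lambda>y. lambda_can y w) (at z) = (\<lambda>u. lambda_can u w)" for w
    by (metis frechet_derivative_at)
  then show ?thesis
    by (simp add: omega_can_def exterior_derivative_def lambda_can_def)
qed

definition pullback ::
  "(coords \<Rightarrow> coords) \<Rightarrow> (coords \<Rightarrow> coords \<Rightarrow> coords \<Rightarrow> real) \<Rightarrow> coords \<Rightarrow> coords \<Rightarrow> coords \<Rightarrow> real"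
  where "pullback F \<omega> z u w =
    \<omega> (F z) (frechet_derivative F (at z) u) (frechet_derivative F (at z) w)"

definition preserves_omega_on :: "cotangent set \<Rightarrow> (cotangent \<Rightarrow> cotangent) \<Rightarrow> bool"
  where "preserves_omega_on U \<Phi> \<longleftrightarrow>
    (\<forall>W F. local_lift \<Phi> F W \<and> cover ` W \<subseteq> U \<longrightarrow>
      (\<forall>z\<in>W. pullback F omega_can z = omega_can z))"

text \<open>The set \<open>S\<close> need not be open: the map is required to extend to a symplectic embedding
  of an open neighbourhood. If \<open>S\<close> is open, one may take \<open>U = S\<close>.\<close>

definition symplectic_embedding ::
  "(cotangent \<Rightarrow> cotangent) \<Rightarrow> cotangent set \<Rightarrow> cotangent set \<Rightarrow> bool"
  where "symplectic_embedding \<phi> S Y \<longleftrightarrow> \<phi> ` S \<subseteq> Y \<and>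
    (\<exists>U \<Phi>. open U \<and> S \<subseteq> U \<and> smooth_embedding_on U \<Phi> \<and> preserves_omega_on U \<Phi> \<and>
      (\<forall>x\<in>S. \<phi> x = \<Phi> x))"

definition irrational_vec :: "real^2 \<Rightarrow> bool"
  where "irrational_vec v \<longleftrightarrow> \<not> (\<exists>c z. integer_vec z \<and> v = c *\<^sub>R z)"

definition P4 :: "real \<Rightarrow> cotangent set"
  where "P4 r = UNIV \<times> {x. 0 \<le> x $ 1 \<and> 0 \<le> x $ 2 \<and> x $ 1 + x $ 2 \<le> r}"

definition Y4 :: "real \<Rightarrow> real^2 \<Rightarrow> cotangent set"
  where "Y4 r v = UNIV \<times> {s *\<^sub>R v + w | s w. s \<in> {-r<..<r} \<and> v \<bullet> w = 0}"

lemma Y4_eq: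
  assumes "norm v = 1"
  shows "Y4 r v = {(q, p). \<bar>p \<bullet> v\<bar> < r}"
proof -
  have vv: "v \<bullet> v = 1"
    using assms by (simp add: dot_square_norm)
  have "(\<exists>s w. p = s *\<^sub>R v + w \<and> s \<in> {-r<..<r} \<and> v \<bullet> w = 0) \<longleftrightarrow> \<bar>p \<bullet> v\<bar> < r" for p
  proof
    assume "\<exists>s w. p = s *\<^sub>R v + w \<and> s \<in> {-r<..<r} \<and> v \<bullet> w = 0"
    then show "\<bar>p \<bullet> v\<bar> < r"
      using vv by (auto simp: inner_add_left inner_add_right inner_commute)
  next
    assume "\<bar>p \<bullet> v\<bar> < r"
    then have "p = (p \<bullet> v) *\<^sub>R v + (p - (p \<bullet> v) *\<^sub>R v) \<and> p \<bullet> v \<in> {-r<..<r} \<and>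
        v \<bullet> (p - (p \<bullet> v) *\<^sub>R v) = 0"
      using vv by (auto simp: inner_diff_right inner_commute)
    then show "\<exists>s w. p = s *\<^sub>R v + w \<and> s \<in> {-r<..<r} \<and> v \<bullet> w = 0"
      by blast
  qed
  then show ?thesis
    by (auto simp: Y4_def)
qed

definition fibre_bounded :: "cotangent set \<Rightarrow> bool"
  where "fibre_bounded D \<longleftrightarrow> bounded (snd ` D)"

end

theory Submission
  imports Defs
begin

text \<open>
  A matrix \<open>A \<in> GL\<^sub>2(\<int>)\<close> acts on the torus, and its cotangent lift
  \<open>(q, p) \<mapsto> (A q, M\<^sup>T p)\<close>, with \<open>M = A\<^sup>-\<^sup>1\<close>, is a linear symplectomorphism of the
  whole cotangent bundle. The quantity that decides membership in \<open>Y4 1 v\<close> changes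
  from \<open>p \<bullet> v\<close> to \<open>M\<^sup>T p \<bullet> v = p \<bullet> M v\<close>, whose absolute value is
  at most \<open>norm p * norm (M v)\<close>.
  So everything whose fibre coordinates are bounded by \<open>B\<close> is moved into \<open>Y4 1 v\<close> as soon
  as \<open>B * norm (M v) < 1\<close>, and the theorem comes down to an arithmetic fact: for
  irrational \<open>v\<close> the orbit \<open>GL\<^sub>2(\<int>) v\<close> accumulates at \<open>0\<close>
  (\<open>unimodular_matrix_shrinking_irrational_vec\<close>).

  For the latter, Dirichlet's approximation theorem gives a primitive integer vector
  \<open>a\<close> with \<open>a \<bullet> v\<close> small, and irrationality makes this number nonzero. Completing \<open>a\<close> to a
  basis \<open>(a, b)\<close> of the integer lattice and subtracting a multiple of \<open>a\<close> from \<open>b\<close>, the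
  number \<open>b \<bullet> v\<close> becomes a remainder modulo \<open>a \<bullet> v\<close>, so it is small too. The rows of \<open>M\<close>
  are \<open>a\<close> and \<open>b\<close>.

  On the geometric side, the symplectic condition speaks about every smooth local lift of the
  map to the universal cover. Any two lifts differ locally by a constant, because their
  difference is continuous and takes values in a discrete set
  (\<open>local_lift_has_derivative\<close>), so it suffices to inspect the linear lift.
\<close>

section \<open>Unimodular matrices that shrink an irrational vector\<close>

definition integer_mat :: "real^2^2 \<Rightarrow> bool"
  where "integer_mat A \<longleftrightarrow> (\<forall>i j. A $ i $ j \<in> \<int>)"

lemma irrational_vec_first_nonzero:
  assumes "irrational_vec v"
  shows "v $ 1 \<noteq> 0"
proof
  assume "v $ 1 = 0"
  then have "v = (v $ 2) *\<^sub>R vector [0, 1]"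
    by (simp add: vec_eq_iff forall_2)
  moreover have "integer_vec (vector [0, 1])"
    by (simp add: integer_vec_def forall_2)
  ultimately show False
    using assms unfolding irrational_vec_def by blast
qed

lemma irrational_vec_integer_combination_nonzero:
  fixes h k :: int
  assumes "irrational_vec v" and "k \<noteq> 0"
  shows "k * v $ 2 - h * v $ 1 \<noteq> 0"
proof
  assume "k * v $ 2 - h * v $ 1 = 0"
  then have "v = (v $ 1 / k) *\<^sub>R vector [of_int k, of_int h]"
    using assms(2) by (simp add: vec_eq_iff forall_2 field_simps)
  moreover have "integer_vec (vector [of_int k, of_int h])"
    by (simp add: integer_vec_def forall_2)
  ultimately show False
    using assms(1) unfolding irrational_vec_def by blast
qed

text \<open>Dirichlet's theorem for the slope of \<open>v\<close>, multiplied through by \<open>v $ 1\<close>. Coprimality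
  is what allows the pair to be completed to a basis of the integer lattice.\<close>

lemma irrational_vec_small_primitive_combination:
  assumes "irrational_vec v" and "0 < e"
  obtains h k :: int where "coprime h k" and "k * v $ 2 - h * v $ 1 \<noteq> 0"
    and "\<bar>k * v $ 2 - h * v $ 1\<bar> < e"
proof -
  have v1: "v $ 1 \<noteq> 0"
    using irrational_vec_first_nonzero[OF assms(1)] .
  obtain N :: nat where N: "\<bar>v $ 1\<bar> / e < N"
    using reals_Archimedean2 by blast
  have "0 \<le> \<bar>v $ 1\<bar> / e"
    using assms(2) by simp
  with N have N0: "0 < N"
    by linarith
  obtain h k :: int where hk: "coprime h k" "0 < k" "\<bar>k * (v $ 2 / v $ 1) - h\<bar> < 1 / N"
    by (rule Dirichlet_approx_coprime[OF N0])
  have "k * v $ 2 - h * v $ 1 = (k * (v $ 2 / v $ 1) - h) * v $ 1"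
    using v1 by (simp add: field_simps)
  then have "\<bar>k * v $ 2 - h * v $ 1\<bar> < 1 / N * \<bar>v $ 1\<bar>"
    using hk(3) v1 by (simp only: abs_mult) (intro mult_strict_right_mono, auto)
  also have "\<dots> < e"
    using N N0 assms(2) by (simp add: field_simps)
  finally show thesis
    using that hk irrational_vec_integer_combination_nonzero[OF assms(1), of k h] by auto
qed

lemma unimodular_matrix_shrinking_irrational_vec:
  assumes "irrational_vec v" and "0 < e"
  obtains A M where "integer_mat A" and "integer_mat M" and "A ** M = mat 1"
    and "norm (M *v v) < e"
proof -
  obtain h k :: int where hk: "coprime h k" and nz: "k * v $ 2 - h * v $ 1 \<noteq> 0"
    and small: "\<bar>k * v $ 2 - h * v $ 1\<bar> < e / 2"
    using irrational_vec_small_primitive_combination[OF assms(1), of "e / 2"] assms(2) by auto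
  define \<delta> where "\<delta> = k * v $ 2 - h * v $ 1"
  obtain s t where st: "s * h + t * k = 1"
    using hk bezout_int[of h k] by auto
  \<comment> \<open>The row \<open>(t, s)\<close> completes \<open>(-h, k)\<close> to a matrix of determinant \<open>-1\<close>; subtracting \<open>n\<close>
    times the first row leaves the fractional part of \<open>(t * v $ 1 + s * v $ 2) / \<delta>\<close>, times \<open>\<delta>\<close>.\<close>
  define n where "n = \<lfloor>(t * v $ 1 + s * v $ 2) / \<delta>\<rfloor>"
  define x where "x = t + n * h"
  define y where "y = s - n * k"
  define M :: "real^2^2" where
    "M = vector [vector [- of_int h, of_int k], vector [of_int x, of_int y]]"
  define A :: "real^2^2" where
    "A = vector [vector [- of_int y, of_int k], vector [of_int x, of_int h]]"
  have "y * h + k * x = 1"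
    using st unfolding x_def y_def by (simp add: algebra_simps)
  then have det: "real_of_int y * h + k * x = 1"
    by (metis of_int_1 of_int_add of_int_mult)
  have inverse: "A ** M = mat 1"
    unfolding A_def M_def
    using det
    by (simp add: vec_eq_iff forall_2 matrix_matrix_mult_def sum_2 mat_def algebra_simps)
  have "x * v $ 1 + y * v $ 2 = frac ((t * v $ 1 + s * v $ 2) / \<delta>) * \<delta>"
    using nz unfolding x_def y_def n_def frac_def \<delta>_def[symmetric]
    by (simp add: left_diff_distrib) (simp add: \<delta>_def algebra_simps)
  then have "\<bar>x * v $ 1 + y * v $ 2\<bar> \<le> 1 * \<bar>\<delta>\<bar>"
    by (simp only: abs_mult) (intro mult_right_mono, auto simp: less_imp_le[OF frac_lt_1])
  then have second: "\<bar>x * v $ 1 + y * v $ 2\<bar> < e / 2"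
    using small unfolding \<delta>_def mult_1 by (rule le_less_trans)
  have "norm (M *v v) \<le> (\<Sum>i\<in>UNIV. \<bar>(M *v v) $ i\<bar>)"
    by (rule norm_le_l1_cart)
  also have "\<dots> = \<bar>k * v $ 2 - h * v $ 1\<bar> + \<bar>x * v $ 1 + y * v $ 2\<bar>"
    by (simp add: M_def sum_2 matrix_vector_mult_def)
  also have "\<dots> < e"
    using small second by linarith
  finally have "norm (M *v v) < e" .
  moreover have "integer_mat A" "integer_mat M"
    by (simp_all add: integer_mat_def A_def M_def forall_2)
  ultimately show thesis
    using that inverse by blast
qed

section \<open>Linear maps are smooth\<close>

lemma C_k_const: "C_k k (\<lambda>_. c) S"
  by (induction k arbitrary: c) simp_all

lemma smooth_on_linear:
  assumes "bounded_linear L"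
  shows "smooth_on L S"
  unfolding smooth_on_def
proof
  fix k
  have deriv: "(L has_derivative L) (at x)" for x
    using assms by (rule bounded_linear_imp_has_derivative)
  show "C_k k L S"
  proof (cases k)
    case 0
    then show ?thesis
      using assms by (simp add: linear_continuous_on)
  next
    case (Suc j)
    have "frechet_derivative L (at x) = L" for x
      using frechet_derivative_at[OF deriv] by simp
    with Suc deriv show ?thesis
      by (auto simp: C_k_const differentiable_def)
  qed
qed

section \<open>Derivatives of local lifts\<close>

lemma cover_eq_iff: "cover y = cover z \<longleftrightarrow> integer_vec (fst y - fst z) \<and> snd y = snd z"
  by (cases y; cases z) (simp add: cover_def torus.abs_eq_iff torus_rel_def)

lemma cover_surj: "\<exists>z. cover z = c"
proof (cases c)
  case (Pair a p)
  have "cover (rep_torus a, p) = c"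
    by (simp add: Pair cover_def Quotient3_abs_rep[OF Quotient3_torus])
  then show ?thesis ..
qed

lemma integer_vec_norm_less_1:
  assumes "integer_vec a" and "norm a < 1"
  shows "a = 0"
proof -
  have "a $ i = 0" for i
  proof (rule ccontr)
    assume "a $ i \<noteq> 0"
    moreover have "a $ i \<in> \<int>"
      using assms(1) by (simp add: integer_vec_def)
    ultimately have "1 \<le> \<bar>a $ i\<bar>"
      by (rule Ints_nonzero_abs_ge1[rotated])
    also have "\<dots> \<le> norm a"
      by (rule component_le_norm_cart)
    finally show False
      using assms(2) by simp
  qed
  then show ?thesis
    by (simp add: vec_eq_iff)
qed

text \<open>Two lifts of the same map differ by an integer translation of the base coordinate.
  The translation depends continuously on the point, so it is locally constant and the two
  lifts have the same derivative.\<close>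

lemma local_lift_has_derivative:
  assumes lift: "local_lift \<Phi> F W" and z: "z \<in> W"
    and G: "\<And>w. cover (G w) = \<Phi> (cover w)" and deriv: "(G has_derivative G') (at z)"
  shows "(F has_derivative G') (at z)"
proof -
  define D where "D w = F w - G w" for w
  have "open W" and "C_k 0 F W"
    using lift unfolding local_lift_def smooth_on_def by blast+
  then have "isCont F z"
    using z by (simp add: continuous_on_eq_continuous_at)
  then have "isCont D z"
    unfolding D_def using has_derivative_continuous[OF deriv] by (intro continuous_intros)
  then have "\<forall>\<^sub>F w in at z. dist (D w) (D z) < 1"
    unfolding isCont_def by (rule tendstoD) simp
  moreover have "\<forall>\<^sub>F w in at z. w \<in> W"
    using \<open>open W\<close> z by (rule eventually_at_in_open')
  ultimately have "\<forall>\<^sub>F w in at z. F w = G w + D z"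
  proof eventually_elim
    case (elim w)
    have D: "integer_vec (fst (D x))" "snd (D x) = 0" if "x \<in> W" for x
    proof -
      have "cover (F x) = cover (G x)"
        using lift that G by (simp add: local_lift_def)
      then show "integer_vec (fst (D x))" "snd (D x) = 0"
        by (simp_all add: cover_eq_iff D_def)
    qed
    have "integer_vec (fst (D w) - fst (D z))"
      using D(1)[OF elim(2)] D(1)[OF z] by (simp add: integer_vec_def)
    moreover have "norm (fst (D w) - fst (D z)) < 1"
      using elim(1) dist_fst_le[of "D w" "D z"] by (simp add: dist_norm)
    ultimately have "fst (D w) = fst (D z)"
      using integer_vec_norm_less_1 by fastforce
    then have "D w = D z"
      using D(2)[OF elim(2)] D(2)[OF z] by (simp add: prod_eq_iff)
    then show ?case
      by (simp add: D_def algebra_simps)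
  qed
  moreover have "((\<lambda>w. G w + D z) has_derivative G') (at z)"
    using deriv by (auto intro!: derivative_eq_intros)
  ultimately show ?thesis
    by (intro has_derivative_transform_eventually[of "\<lambda>w. G w + D z" G' z UNIV F])
      (auto simp: D_def elim: eventually_mono)
qed

section \<open>Cotangent lifts of toral automorphisms\<close>

definition torus_map :: "real^2^2 \<Rightarrow> torus \<Rightarrow> torus"
  where "torus_map A a = proj_torus (A *v rep_torus a)"

text \<open>\<open>M\<close> stands for the inverse of \<open>A\<close>. Keeping it as a second argument makes the
  inverse of the lift the lift with the two arguments exchanged.\<close>

definition cotangent_lift :: "real^2^2 \<Rightarrow> real^2^2 \<Rightarrow> cotangent \<Rightarrow> cotangent"
  where "cotangent_lift A M = map_prod (torus_map A) (\<lambda>p. transpose M *v p)"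

definition linear_lift :: "real^2^2 \<Rightarrow> real^2^2 \<Rightarrow> coords \<Rightarrow> coords"
  where "linear_lift A M = map_prod (\<lambda>q. A *v q) (\<lambda>p. transpose M *v p)"

lemma torus_map_proj:
  assumes "integer_mat A"
  shows "torus_map A (proj_torus q) = proj_torus (A *v q)"
proof -
  have "torus_rel (rep_torus (proj_torus q)) q"
    by (metis Quotient3_abs_rep[OF Quotient3_torus] torus.abs_eq_iff)
  then have "integer_vec (A *v (rep_torus (proj_torus q) - q))"
    using assms
    by (auto simp: torus_rel_def integer_vec_def integer_mat_def matrix_vector_mult_def
        intro!: Ints_sum Ints_mult)
  then show ?thesis
    by (simp add: torus_map_def torus.abs_eq_iff torus_rel_def matrix_vector_mult_diff_distrib)
qed

lemma cover_linear_lift: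
  assumes "integer_mat A"
  shows "cover (linear_lift A M z) = cotangent_lift A M (cover z)"
  using assms by (cases z) (simp add: cover_def linear_lift_def cotangent_lift_def torus_map_proj)

lemma bounded_linear_linear_lift: "bounded_linear (linear_lift A M)"
  unfolding linear_lift_def map_prod_def case_prod_beta
  by (intro bounded_linear_Pair bounded_linear_compose[OF matrix_vector_mul_bounded_linear]
      bounded_linear_fst bounded_linear_snd)

lemma linear_lift_has_derivative: "(linear_lift A M has_derivative linear_lift A M) (at z)"
  using bounded_linear_linear_lift by (rule bounded_linear_imp_has_derivative)

lemma continuous_on_torus_map:
  assumes "integer_mat A"
  shows "continuous_on UNIV (torus_map A)"
proof -
  have "open (torus_map A -` U)" if "open U" for U
  proof -
    have "proj_torus -` (torus_map A -` U) = (\<lambda>q. A *v q) -` (proj_torus -` U)"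
      using torus_map_proj[OF assms] by auto
    moreover have "open (\<dots>)"
    proof (rule open_vimage)
      show "open (proj_torus -` U)"
        using that by (simp add: open_torus_def)
      show "continuous_on UNIV (\<lambda>q. A *v q)"
        by (intro linear_continuous_on matrix_vector_mul_bounded_linear)
    qed
    ultimately show ?thesis
      by (simp add: open_torus_def)
  qed
  then show ?thesis
    by (simp add: continuous_on_open_vimage)
qed

lemma continuous_on_cotangent_lift:
  assumes "integer_mat A"
  shows "continuous_on UNIV (cotangent_lift A M)"
proof -
  have "continuous_on UNIV (\<lambda>c::cotangent. torus_map A (fst c))"
    by (rule continuous_on_compose2[OF continuous_on_torus_map[OF assms]])
      (auto intro: continuous_intros)
  moreover have "continuous_on UNIV (\<lambda>c::cotangent. transpose M *v snd c)"
    by (intro bounded_linear.continuous_on[OF matrix_vector_mul_bounded_linear] continuous_intros)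
  ultimately show ?thesis
    unfolding cotangent_lift_def map_prod_def case_prod_beta by (rule continuous_on_Pair)
qed

lemma linear_lift_inverse:
  assumes "A ** M = mat 1"
  shows "linear_lift A M (linear_lift M A z) = z"
  using assms
  by (cases z) (simp add: linear_lift_def matrix_vector_mul_assoc vector_matrix_mul_assoc)

lemma cotangent_lift_inverse:
  assumes "integer_mat A" and "integer_mat M" and "A ** M = mat 1"
  shows "cotangent_lift A M (cotangent_lift M A c) = c"
proof -
  obtain z where "cover z = c"
    using cover_surj by blast
  then show ?thesis
    using assms by (metis cover_linear_lift linear_lift_inverse)
qed

text \<open>The cotangent lift pairs the action of \<open>A\<close> on velocities with the inverse transpose
  action on momenta, so the pairing between the two, and with it the symplectic form,
  is preserved.\<close>

lemma omega_can_linear_lift: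
  assumes "M ** A = mat 1"
  shows "omega_can x (linear_lift A M u) (linear_lift A M w) = omega_can z u w"
proof -
  have "(transpose M *v p) \<bullet> (A *v q) = p \<bullet> q" for p q :: "real^2"
  proof -
    have "(transpose M *v p) \<bullet> (A *v q) = p \<bullet> (M *v (A *v q))"
      by (simp add: dot_lmul_matrix transpose_matrix_vector)
    then show ?thesis
      using assms by (simp add: matrix_vector_mul_assoc)
  qed
  then show ?thesis
    by (simp add: omega_can_eq linear_lift_def)
qed

lemma symplectic_embedding_cotangent_lift:
  assumes A: "integer_mat A" and M: "integer_mat M" and AM: "A ** M = mat 1"
    and into: "cotangent_lift A M ` S \<subseteq> Y"
  shows "symplectic_embedding (cotangent_lift A M) S Y"
proof -
  let ?\<Phi> = "cotangent_lift A M" and ?L = "linear_lift A M"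
  have MA: "M ** A = mat 1"
    using AM matrix_left_right_inverse by blast
  have deriv: "frechet_derivative F (at z) = ?L" if "local_lift ?\<Phi> F W" "z \<in> W" for F W z
    using local_lift_has_derivative[OF that cover_linear_lift[OF A] linear_lift_has_derivative]
    by (rule frechet_derivative_at[symmetric])
  have "local_lift ?\<Phi> ?L UNIV"
    by (simp add: local_lift_def smooth_on_linear bounded_linear_linear_lift cover_linear_lift A)
  then have "smooth_map_on UNIV ?\<Phi>"
    unfolding smooth_map_on_def by blast
  moreover have "inj ?L"
    using linear_lift_inverse[OF MA] by (rule inj_on_inverseI)
  ultimately have "immersion_on UNIV ?\<Phi>"
    by (auto simp: immersion_on_def deriv)
  moreover have "homeomorphism UNIV (?\<Phi> ` UNIV) ?\<Phi> (cotangent_lift M A)"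
    using cotangent_lift_inverse[OF M A MA] cotangent_lift_inverse[OF A M AM]
      continuous_on_cotangent_lift[OF A] continuous_on_subset[OF continuous_on_cotangent_lift[OF M]]
    by (intro homeomorphismI) auto
  ultimately have "smooth_embedding_on UNIV ?\<Phi>"
    unfolding smooth_embedding_on_def by blast
  moreover have "preserves_omega_on UNIV ?\<Phi>"
    by (auto simp: preserves_omega_on_def pullback_def fun_eq_iff deriv omega_can_linear_lift[OF MA])
  ultimately show ?thesis
    unfolding symplectic_embedding_def using into
    by (intro conjI exI[of _ UNIV] exI[of _ ?\<Phi>]) auto
qed

section \<open>Embedding fibre bounded sets\<close>

lemma fibre_bounded_symplectic_embedding:
  assumes "norm v = 1" and "irrational_vec v" and "fibre_bounded D"
  shows "\<exists>\<phi>. symplectic_embedding \<phi> D (Y4 1 v)"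
proof -
  obtain B where B: "0 < B" "\<And>c. c \<in> D \<Longrightarrow> norm (snd c) \<le> B"
    using assms(3) unfolding fibre_bounded_def bounded_pos by auto
  obtain A M where AM: "integer_mat A" "integer_mat M" "A ** M = mat 1"
    and small: "norm (M *v v) < 1 / B"
    using unimodular_matrix_shrinking_irrational_vec[OF assms(2), of "1 / B"] B(1) by auto
  have "\<bar>(transpose M *v snd c) \<bullet> v\<bar> < 1" if "c \<in> D" for c
  proof -
    have "(transpose M *v snd c) \<bullet> v = snd c \<bullet> (M *v v)"
      by (simp add: dot_lmul_matrix transpose_matrix_vector)
    also have "\<bar>\<dots>\<bar> \<le> norm (snd c) * norm (M *v v)"
      by (rule Cauchy_Schwarz_ineq2)
    also have "\<dots> \<le> B * norm (M *v v)"
      using B(2)[OF that] by (rule mult_right_mono) simp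
    also have "\<dots> < 1"
      using small B(1) by (simp add: field_simps)
    finally show ?thesis .
  qed
  then have "cotangent_lift A M ` D \<subseteq> Y4 1 v"
    by (auto simp: Y4_eq[OF assms(1)] cotangent_lift_def map_prod_def case_prod_beta)
  then show ?thesis
    using symplectic_embedding_cotangent_lift[OF AM] by blast
qed

lemma fibre_bounded_P4: "fibre_bounded (P4 r)"
proof -
  have "norm x \<le> r" if "0 \<le> x $ 1" "0 \<le> x $ 2" "x $ 1 + x $ 2 \<le> r" for x :: "real^2"
    using norm_le_l1_cart[of x] that by (simp add: sum_2)
  then show ?thesis
    unfolding fibre_bounded_def P4_def bounded_iff by auto
qed

theorem theorem1:
  fixes v :: "real^2"
  assumes "norm v = 1" and "irrational_vec v"
  shows "(\<forall>r>0. \<exists>\<phi>. symplectic_embedding \<phi> (P4 r) (Y4 1 v)) \<and>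
    (\<forall>D. fibre_bounded D \<longrightarrow> (\<exists>\<phi>. symplectic_embedding \<phi> D (Y4 1 v)))"
  using fibre_bounded_symplectic_embedding[OF assms] fibre_bounded_P4 by blast

end
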